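(* For all $u,x\in\mathbb{R}$ there is a probability distribution $\mu$ on $\mathbb{R}$ (with compact support) whose free $R$-transform is \[ R_\mu(w)=u^2x^3w^2+\frac{(1-x)^3uw}{1-uw}. \]
   Context: For a compactly supported probability distribution $\mu$ on $\mathbb{R}$ let $M_\mu(z)=\int_{\mathbb{R}}\frac{\mu(dx)}{1-xz}$ for $z$ near $0$. The free $R$-transform $R_\mu$ is the analytic function near $0$ determined by $1+R_\mu(zM_\mu(z))=M_\mu(z)$ for $z$ near $0$. *)

theory Defs
  imports
    "HOL-Probability.Distribution_Functions"
    "HOL-Complex_Analysis.Complex_Analysis"
begin

definition compactly_supported :: "real measure \<Rightarrow> bool" where
  "compactly_supported \<mu> \<longleftrightarrow> (\<exists>K. compact K \<and> (AE x in \<mu>. x \<in> K))"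

definition moment_transform :: "real measure \<Rightarrow> complex \<Rightarrow> complex" where
  "moment_transform \<mu> z = (\<integral>x. 1 / (1 - complex_of_real x * z) \<partial>\<mu>)"

text \<open>
  The free R-transform is a germ of an analytic function at \<open>0\<close>, so it is rendered as a relation
  between \<open>\<mu>\<close> and its representatives. Lemma \<open>free_R_transform_unique\<close> below shows that the
  germ is determined by \<open>\<mu>\<close>.
\<close>
definition is_free_R_transform :: "real measure \<Rightarrow> (complex \<Rightarrow> complex) \<Rightarrow> bool" where
  "is_free_R_transform \<mu> R \<longleftrightarrow>
     R analytic_on {0} \<and>
     (\<forall>\<^sub>F z in nhds 0. 1 + R (z * moment_transform \<mu> z) = moment_transform \<mu> z)"

lemma free_R_transform_unique:
  assumes "real_distribution \<mu>" "compactly_supported \<mu>"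
    and R: "is_free_R_transform \<mu> R" and S: "is_free_R_transform \<mu> S"
  shows "\<forall>\<^sub>F w in nhds 0. R w = S w"
proof -
  interpret real_distribution \<mu> by fact
  obtain K where K: "compact K" "AE x in \<mu>. x \<in> K"
    using assms(2) by (auto simp: compactly_supported_def)
  obtain B where B: "B > 0" "\<And>x. x \<in> K \<Longrightarrow> \<bar>x\<bar> \<le> B"
    using compact_imp_bounded[OF K(1)] by (auto simp: bounded_pos)
  define N where "N = nat \<lceil>2 * B\<rceil> + 1"
  have N: "real N \<ge> 2 * B" "N > 0" unfolding N_def using B by linarith+
  define z where "z n = complex_of_real (1 / real (n + N))" for n
  have z0: "z \<longlonglongrightarrow> 0"
    unfolding z_def using tendsto_of_real[OF LIMSEQ_ignore_initial_segment[OF lim_1_over_n, of N], where ?'a = complex]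
    by simp
  have z_ne: "z n \<noteq> 0" for n using N by (simp add: z_def del: of_nat_add)
  let ?M = "moment_transform \<mu>"
  have bound: "norm (1 / (1 - complex_of_real x * z n)) \<le> 2" if "x \<in> K" for x n
  proof -
    have "norm (complex_of_real x * z n) = \<bar>x\<bar> / real (n + N)"
      by (simp add: z_def norm_mult norm_divide del: of_nat_add)
    also have "\<dots> \<le> 1 / 2"
      using B(2)[OF that] N by (simp add: field_simps)
    finally have "norm (1 - complex_of_real x * z n) \<ge> 1 / 2"
      using norm_triangle_ineq2[of 1 "complex_of_real x * z n"] by simp
    then have "inverse (norm (1 - complex_of_real x * z n)) \<le> inverse (1 / 2)"
      by (intro le_imp_inverse_le) auto
    then show ?thesis by (simp add: norm_divide inverse_eq_divide)
  qed
  have "(\<lambda>n. ?M (z n)) \<longlonglongrightarrow> (\<integral>x. 1 \<partial>\<mu>)"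
    unfolding moment_transform_def
  proof (rule integral_dominated_convergence[where w = "\<lambda>_. 2"])
    show "AE x in \<mu>. (\<lambda>n. 1 / (1 - complex_of_real x * z n)) \<longlonglongrightarrow> 1"
    proof (rule AE_I2)
      fix x
      have "(\<lambda>n. 1 / (1 - complex_of_real x * z n)) \<longlonglongrightarrow> 1 / (1 - complex_of_real x * 0)"
        by (intro tendsto_intros z0) simp
      then show "(\<lambda>n. 1 / (1 - complex_of_real x * z n)) \<longlonglongrightarrow> 1" by simp
    qed
    show "AE x in \<mu>. norm (1 / (1 - complex_of_real x * z n)) \<le> 2" for n
      using K(2) by eventually_elim (rule bound)
  qed (auto)
  then have M1: "(\<lambda>n. ?M (z n)) \<longlonglongrightarrow> 1"
    using prob_space by simp
  have "(\<lambda>n. z n * ?M (z n)) \<longlonglongrightarrow> 0"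
    using tendsto_mult[OF z0 M1] by simp
  moreover have "\<forall>\<^sub>F n in sequentially. z n * ?M (z n) \<noteq> 0"
    using tendsto_imp_eventually_ne[OF M1 one_neq_zero]
    by eventually_elim (simp add: z_ne)
  ultimately have lim: "filterlim (\<lambda>n. z n * ?M (z n)) (at 0) sequentially"
    by (simp add: filterlim_at)
  have "\<forall>\<^sub>F z in nhds 0. R (z * ?M z) - S (z * ?M z) = 0"
    using R[unfolded is_free_R_transform_def, THEN conjunct2]
      S[unfolded is_free_R_transform_def, THEN conjunct2]
    by eventually_elim (metis add_left_cancel diff_self)
  then have "\<forall>\<^sub>F n in sequentially. R (z n * ?M (z n)) - S (z n * ?M (z n)) = 0"
    using z0 by (rule eventually_compose_filterlim)
  then have "\<exists>\<^sub>F n in sequentially. R (z n * ?M (z n)) - S (z n * ?M (z n)) = 0"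
    by (rule eventually_frequently[rotated]) simp
  then have freq: "\<exists>\<^sub>F w in at 0. R w - S w = 0"
    using lim by (auto simp: frequently_def dest: eventually_compose_filterlim)
  have an: "(\<lambda>w. R w - S w) analytic_on {0}"
    using R S by (auto simp: is_free_R_transform_def intro!: analytic_intros)
  have ev: "\<forall>\<^sub>F w in at 0. R w - S w = 0"
    using freq an by (metis isolated_singularity_at_analytic not_essential_analytic
        not_essential_frequently_0_imp_eventually_0)
  have "(\<lambda>w. R w - S w) \<midarrow>0\<rightarrow> R 0 - S 0"
    using an analytic_at_imp_isCont isContD by blast
  moreover have "(\<lambda>w. R w - S w) \<midarrow>0\<rightarrow> 0"
    using ev by (rule tendsto_eventually)
  ultimately have "R 0 - S 0 = 0"
    using LIM_unique by blast
  with ev show ?thesis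
    by (simp add: eventually_nhds_conv_at)
qed

end

theory Submission
  imports Defs "HOL-Probability.Helly_Selection"
begin

text \<open>
  Put \<open>w = z M(z)\<close>. For \<open>u = 1\<close> the functional equation reads \<open>1 / z = K(w)\<close> with
  \<open>K(w) = 1 / w + x^3 w + (1 - x)^3 / (1 - w)\<close>, and \<open>K\<close> has a double critical point at \<open>w = 1 / x\<close>:
  \<open>K(w) - (3 x^2 - x^3) = (1 - x w)^3 / (w (1 - w))\<close>. In the coordinate \<open>r = w / (1 - x w)\<close> this
  becomes the polynomial equation \<open>r (1 + x r) (1 - (1 - x) r) = s\<close>, where
  \<open>1 / s = 1 / z - (3 x^2 - x^3)\<close>. All roots of the cubic are real and simple, and the critical values lie on
  both sides of \<open>0\<close>, so the branch with \<open>r(0) = 0\<close> extends to the plane slit along two real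
  half-lines. As the cubic is real, \<open>r\<close> maps the upper half-plane into itself, and so does the
  Moebius image \<open>w\<close>. Every such function on a slit plane is \<open>s\<close> times the moment transform of a
  distribution on an interval; the shift by \<open>3 x^2 - x^3\<close> and the dilation by \<open>u\<close> are then undone on
  the distribution.
\<close>

section \<open>Circle integrals, slit planes and the Joukowski map\<close>

lemma Cauchy_circle_mean:
  fixes f :: "complex \<Rightarrow> complex"
  assumes f: "f holomorphic_on cball 0 1" and k: "norm k < 1"
  shows "((\<lambda>t. f (cis (2 * pi * t)) * (cis (2 * pi * t) / (cis (2 * pi * t) - k)))
           has_integral f k) {0..1}"
proof -
  have "((\<lambda>u. f u / (u - k)) has_contour_integral (2 * of_real pi * \<i> * f k)) (circlepath 0 1)"
    using Cauchy_integral_circlepath_simple[OF f] k by simp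
  then have "((\<lambda>t. f (cis (2 * pi * t)) / (cis (2 * pi * t) - k) * (2 * pi * \<i> * cis (2 * pi * t)))
      has_integral (2 * of_real pi * \<i> * f k)) {0..1}"
    unfolding has_contour_integral_def
    by (rule has_integral_eq[rotated])
       (simp add: vector_derivative_circlepath01, simp add: circlepath cis_conv_exp mult_ac)
  from has_integral_mult_right[OF this, of "1 / (2 * of_real pi * \<i>)"]
  show ?thesis by (simp add: field_simps)
qed

text \<open>For \<open>s\<close> nonzero the equation \<open>s k^2 - 2 k + s = 0\<close> has two
  roots with product 1, and \<open>s / (1 + csqrt (1 - s^2))\<close> is the small one; this form
  also covers \<open>s = 0\<close>. The principal root has nonnegative real part, so the denominator
  has modulus at least 1 and \<open>norm k\<close> is at most \<open>norm s\<close>.\<close>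

lemma Joukowski_preimage:
  fixes s :: complex
  assumes "norm s < 1"
  obtains k where "norm k < 1" "1 + k\<^sup>2 \<noteq> 0" "2 * k / (1 + k\<^sup>2) = s"
proof -
  define c where "c = csqrt (1 - s\<^sup>2)"
  have c2: "c\<^sup>2 = 1 - s\<^sup>2" by (simp add: c_def)
  have Re: "Re c \<ge> 0" unfolding c_def using csqrt_principal[of "1 - s\<^sup>2"] by linarith
  have c1: "norm (1 + c) \<ge> 1" using abs_Re_le_cmod[of "1 + c"] Re by simp
  then have nz: "1 + c \<noteq> 0" by auto
  define k where "k = s / (1 + c)"
  have "norm k \<le> norm s"
    unfolding k_def norm_divide using c1 by (intro divide_le_eq[THEN iffD2]) (auto simp: mult_le_cancel_left1)
  moreover have e: "1 + k\<^sup>2 = 2 / (1 + c)"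
  proof -
    have "1 + k\<^sup>2 = ((1 + c)\<^sup>2 + s\<^sup>2) / (1 + c)\<^sup>2"
      using nz by (simp add: k_def power_divide add_divide_distrib)
    also have "(1 + c)\<^sup>2 + s\<^sup>2 = 2 * (1 + c)"
      using c2 by (simp add: power2_sum algebra_simps)
    also have "2 * (1 + c) / (1 + c)\<^sup>2 = 2 / (1 + c)"
      unfolding power2_eq_square by (rule mult_divide_mult_cancel_right[OF nz])
    finally show ?thesis .
  qed
  ultimately show ?thesis using assms nz that[of k] by (simp add: e) (simp add: k_def)
qed

text \<open>For \<open>d > 0\<close> the removed points are the reciprocals of the nonzero
  \<open>t\<close> in \<open>[-1/d, 1/d]\<close>: the places where \<open>1 / (1 - t s)\<close> can
  be singular for a distribution on that interval.\<close>

definition slit :: "real \<Rightarrow> complex set" where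
  "slit d = {s. Im s = 0 \<longrightarrow> \<bar>Re s\<bar> < d}"

lemma open_slit: "open (slit d)"
proof -
  have "slit d = {s. Im s < 0} \<union> {s. Im s > 0} \<union> {s. \<bar>Re s\<bar> < d}"
    by (auto simp: slit_def)
  moreover have "open {s. \<bar>Re s\<bar> < d}"
    by (intro open_Collect_less continuous_intros)
  ultimately show ?thesis
    by (auto intro!: open_Un open_halfspace_Im_lt open_halfspace_Im_gt)
qed

lemma slit_scale: "s \<in> slit d \<Longrightarrow> 0 < c \<Longrightarrow> of_real c * s \<in> slit (c * d)"
  by (auto simp: slit_def abs_mult)

lemma connected_slit:
  assumes "d > 0" shows "connected (slit d)"
proof (rule starlike_imp_connected)
  have "of_real t * y \<in> slit d" if "y \<in> slit d" "0 \<le> t" "t \<le> 1" for t y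
  proof (cases "t = 0")
    case True then show ?thesis using assms by (simp add: slit_def)
  next
    case False
    show ?thesis
      unfolding slit_def
    proof safe
      assume "Im (of_real t * y) = 0"
      then have "\<bar>Re y\<bar> < d" using that False by (simp add: slit_def)
      moreover have "\<bar>t * Re y\<bar> \<le> \<bar>Re y\<bar>" using that by (simp add: abs_mult mult_left_le_one_le)
      ultimately show "\<bar>Re (of_real t * y)\<bar> < d" by simp
    qed
  qed
  then have "closed_segment 0 y \<subseteq> slit d" if "y \<in> slit d" for y
    using that by (auto simp: closed_segment_def scaleR_conv_of_real)
  then show "starlike (slit d)"
    unfolding starlike_def using assms by (intro bexI[of _ 0]) (auto simp: slit_def)
qed

text \<open>On the unit disc this shows that the Joukowski map preserves the sign of the imaginary
  part. Both the slit image and the positivity of the density rest on that.\<close>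

lemma Im_Joukowski:
  "Im (2 * z / (1 + z\<^sup>2)) = 2 * Im z * (1 - (norm z)\<^sup>2) / (norm (1 + z\<^sup>2))\<^sup>2"
proof -
  have "2 * z / (1 + z\<^sup>2) = 2 * z * cnj (1 + z\<^sup>2) / of_real ((norm (1 + z\<^sup>2))\<^sup>2)"
    by (subst complex_div_cnj) (simp only: of_real_power)
  also have "2 * z * cnj (1 + z\<^sup>2) = 2 * z + 2 * of_real ((norm z)\<^sup>2) * cnj z"
    by (simp only: complex_norm_square) (simp add: power2_eq_square algebra_simps)
  finally show ?thesis by (simp only: Im_divide_of_real) (simp add: algebra_simps)
qed

lemma Joukowski_in_slit:
  assumes "norm z < 1" shows "2 * z / (1 + z\<^sup>2) \<in> slit 1" "1 + z\<^sup>2 \<noteq> 0"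
proof -
  have n1: "(norm z)\<^sup>2 < 1" using assms by (simp add: power_less_one_iff abs_square_less_1)
  have "norm (z\<^sup>2) < 1" using n1 by (simp add: norm_power)
  then show nz: "1 + z\<^sup>2 \<noteq> 0" by (metis add_eq_0_iff norm_minus_cancel norm_one order_less_irrefl)
  show "2 * z / (1 + z\<^sup>2) \<in> slit 1"
    unfolding slit_def
  proof safe
    assume "Im (2 * z / (1 + z\<^sup>2)) = 0"
    then have "Im z = 0" using nz n1 unfolding Im_Joukowski by simp
    then have z: "z = of_real (Re z)" by (simp add: complex_eq_iff)
    define y where "y = Re z"
    have y: "\<bar>y\<bar> < 1" using assms by (subst (asm) z) (simp add: y_def)
    have "(1 - \<bar>y\<bar>)\<^sup>2 > 0" using y by simp
    then have "2 * \<bar>y\<bar> < 1 + y\<^sup>2" by (simp add: power2_diff)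
    then have "\<bar>2 * y / (1 + y\<^sup>2)\<bar> < 1"
      by (simp add: abs_mult abs_divide divide_less_eq add_pos_nonneg)
    moreover have "2 * z / (1 + z\<^sup>2) = of_real (2 * y / (1 + y\<^sup>2))"
      by (subst (1 2) z) (simp add: y_def)
    ultimately show "\<bar>Re (2 * z / (1 + z\<^sup>2))\<bar> < 1" by simp
  qed
qed

text \<open>Cauchy's formula for the boundary values of \<open>z f z\<close> against the kernel
  gives \<open>\<i> / 2 * f k\<close>. Conjugating the formula at \<open>cnj k\<close> gives
  \<open>- \<i> / 2 * f k\<close> for the conjugate boundary values, by the symmetry of
  \<open>f\<close>. Subtracting the two isolates the imaginary part.\<close>

lemma sin_kernel_integral:
  fixes f :: "complex \<Rightarrow> complex"
  assumes f: "f holomorphic_on cball 0 1" and k: "norm k < 1"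
    and sym: "\<And>z. norm z \<le> 1 \<Longrightarrow> f (cnj z) = cnj (f z)"
  shows "((\<lambda>t. of_real (sin (2 * pi * t) * Im (cis (2 * pi * t) * f (cis (2 * pi * t))))
            / (1 - 2 * k * of_real (cos (2 * pi * t)) + k\<^sup>2)) has_integral f k / 2) {0..1}"
proof -
  define E where "E = (\<lambda>t::real. cis (2 * pi * t))"
  define K where "K = (\<lambda>k t. of_real (sin (2 * pi * t)) / (1 - 2 * k * of_real (cos (2 * pi * t)) + k\<^sup>2) :: complex)"
  have one: "((\<lambda>t. E t * f (E t) * K k t) has_integral \<i> / 2 * f k) {0..1}" if k: "norm k < 1" for k
  proof -
    have nz: "1 - k * z \<noteq> 0" if "norm z \<le> 1" for z
    proof
      assume "1 - k * z = 0"
      then have "norm k * norm z = 1" by (metis norm_mult norm_one eq_iff_diff_eq_0)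
      moreover have "norm k * norm z \<le> norm k" using that by (simp add: mult_left_le)
      ultimately show False using k by simp
    qed
    \<comment> \<open>For \<open>z\<close> on the circle at angle \<theta>,
      \<open>sin \<theta> = (z - 1 / z) / (2 \<i>)\<close> and
      \<open>1 - 2 k cos \<theta> + k^2 = (1 - k z) (z - k) / z\<close>. The factor
      \<open>z - k\<close> is the Cauchy denominator; what remains is holomorphic on the closed
      disc.\<close>
    have "(\<lambda>z. f z * (z\<^sup>2 - 1) / (1 - k * z) / (2 * \<i>)) holomorphic_on cball 0 1"
      by (intro holomorphic_intros f) (use nz in force)+
    from Cauchy_circle_mean[OF this k]
    have *: "((\<lambda>t. f (E t) * ((E t)\<^sup>2 - 1) / (1 - k * E t) / (2 * \<i>) * (E t / (E t - k)))
            has_integral f k * (k\<^sup>2 - 1) / (1 - k * k) / (2 * \<i>)) {0..1}"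
      unfolding E_def .
    have k_val: "f k * (k\<^sup>2 - 1) / (1 - k * k) / (2 * \<i>) = \<i> / 2 * f k"
    proof -
      have "1 - k * k \<noteq> 0" using nz[of k] k by simp
      then have "(k\<^sup>2 - 1) / (1 - k * k) = -1" by (simp add: power2_eq_square divide_eq_eq)
      then have "f k * (k\<^sup>2 - 1) / (1 - k * k) / (2 * \<i>) = f k * (-1) / (2 * \<i>)"
        by (metis times_divide_eq_right)
      also have "\<dots> = \<i> / 2 * f k" by (simp add: field_simps)
      finally show ?thesis .
    qed
    have E_val: "f (E t) * ((E t)\<^sup>2 - 1) / (1 - k * E t) / (2 * \<i>) * (E t / (E t - k))
        = E t * f (E t) * K k t" for t
    proof -
      have nE: "norm (E t) = 1" "E t \<noteq> 0" by (simp_all add: E_def)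
      have n1: "1 - k * E t \<noteq> 0" using nz nE by simp
      have n2: "E t - k \<noteq> 0" using nE k by auto
      have s: "of_real (sin (2 * pi * t)) = (E t - inverse (E t)) / (2 * \<i>)"
        by (simp add: E_def complex_eq_iff cis_inverse)
      have c: "of_real (cos (2 * pi * t)) = (E t + inverse (E t)) / 2"
        by (simp add: E_def complex_eq_iff cis_inverse)
      have "1 - 2 * k * of_real (cos (2 * pi * t)) + k\<^sup>2 = (1 - k * E t) * (E t - k) / E t"
        unfolding c using nE by (simp add: field_simps power2_eq_square)
      moreover have "of_real (sin (2 * pi * t)) = ((E t)\<^sup>2 - 1) / E t / (2 * \<i>)"
        unfolding s using nE by (simp add: field_simps power2_eq_square)
      ultimately have "K k t = ((E t)\<^sup>2 - 1) / E t / (2 * \<i>) / ((1 - k * E t) * (E t - k) / E t)"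
        by (simp only: K_def)
      also have "\<dots> = ((E t)\<^sup>2 - 1) / (1 - k * E t) / (2 * \<i>) * (1 / (E t - k))"
        using nE(2) by (simp add: mult_ac)
      finally show ?thesis by simp
    qed
    from * show ?thesis unfolding k_val E_val .
  qed
  have "((\<lambda>t. cnj (E t * f (E t) * K (cnj k) t)) has_integral cnj (\<i> / 2 * f (cnj k))) {0..1}"
    using one[of "cnj k"] k by (subst has_integral_cnj[symmetric]) (simp add: o_def)
  moreover have "cnj (\<i> / 2 * f (cnj k)) = - \<i> / 2 * f k"
    using sym[of k] k by simp
  moreover have "cnj (K (cnj k) t) = K k t" for t
    by (simp add: K_def)
  ultimately have two: "((\<lambda>t. cnj (E t * f (E t)) * K k t) has_integral - \<i> / 2 * f k) {0..1}"
    by simp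
  have "((\<lambda>t. (E t * f (E t) * K k t - cnj (E t * f (E t)) * K k t) / (2 * \<i>)) has_integral
      (\<i> / 2 * f k - (- \<i> / 2 * f k)) / (2 * \<i>)) {0..1}"
    by (intro has_integral_divide has_integral_diff one[OF k] two)
  moreover have "(\<i> / 2 * f k - (- \<i> / 2 * f k)) / (2 * \<i>) = f k / 2"
    by (simp add: field_simps)
  moreover have "(E t * f (E t) * K k t - cnj (E t * f (E t)) * K k t) / (2 * \<i>)
      = of_real (Im (E t * f (E t))) * K k t" for t
  proof -
    have "of_real (Im z) = (z - cnj z) / (2 * \<i>)" for z
      by (simp add: complex_eq_iff)
    then show ?thesis by (simp only: left_diff_distrib[symmetric]) (simp add: field_simps)
  qed
  ultimately show ?thesis by (simp add: K_def E_def mult_ac)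
qed

lemma one_minus_slit_nonzero:
  assumes "s \<in> slit 1" "\<bar>t\<bar> \<le> 1" shows "1 - of_real t * s \<noteq> 0"
proof
  assume e: "1 - of_real t * s = 0"
  then have "Re (of_real t * s) = 1" "Im (of_real t * s) = 0" by (auto simp: complex_eq_iff)
  then have "t * Re s = 1" "Im s = 0" by auto
  then have "\<bar>Re s\<bar> < 1" "\<bar>t\<bar> * \<bar>Re s\<bar> = 1"
    using assms by (auto simp: slit_def abs_mult[symmetric])
  moreover have "\<bar>t\<bar> * \<bar>Re s\<bar> \<le> 1 * \<bar>Re s\<bar>" using assms by (intro mult_right_mono) auto
  ultimately show False by linarith
qed

section \<open>Distributions on \<open>[-1, 1]\<close> with a prescribed moment transform\<close>

text \<open>Pushing \<open>D t dt\<close> forward along \<open>c\<close> keeps the angle as the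
  variable of integration when \<open>c\<close> is a cosine, so no Jacobian has to be
  computed.\<close>

lemma distribution_with_parametrized_density:
  fixes D c :: "real \<Rightarrow> real"
  assumes D: "continuous_on UNIV D" "\<And>t. D t \<ge> 0" "(D has_integral 1) {0..1}"
    and c: "continuous_on UNIV c" "\<And>t. \<bar>c t\<bar> \<le> B"
  obtains \<nu> where "real_distribution \<nu>" "AE s in \<nu>. \<bar>s\<bar> \<le> B"
    "\<And>\<phi> :: real \<Rightarrow> complex. continuous_on UNIV \<phi> \<Longrightarrow>
      (\<integral>s. \<phi> s \<partial>\<nu>) = integral {0..1} (\<lambda>t. of_real (D t) * \<phi> (c t))"
proof -
  have [measurable]: "D \<in> borel_measurable borel" "c \<in> borel_measurable borel"
    using D c by (auto intro: borel_measurable_continuous_onI)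
  define N where "N = density lborel (\<lambda>t. ennreal (indicator {0..1} t * D t))"
  have [measurable_cong, simp]: "sets N = sets borel" "space N = UNIV"
    by (simp_all add: N_def)
  have "set_integrable lborel {0..1} D"
    by (rule borel_integrable_atLeastAtMost'[OF continuous_on_subset[OF D(1)]]) simp
  moreover have "set_lebesgue_integral lborel {0..1} D = 1"
    using set_borel_integral_eq_integral(2)[OF calculation] D(3) by (simp add: integral_unique)
  ultimately have "(\<integral>\<^sup>+t. ennreal (indicator {0..1} t * D t) \<partial>lborel) = ennreal 1"
    using D(2) by (subst nn_integral_eq_integral) (auto simp: set_integrable_def set_lebesgue_integral_def)
  then interpret N: prob_space N
    by (intro prob_spaceI) (simp add: N_def emeasure_density)
  have cm: "c \<in> measurable N borel" by simp
  show thesis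
  proof (rule that[of "distr N borel c"])
    show "real_distribution (distr N borel c)"
      by (intro real_distribution.intro N.prob_space_distr) (auto simp: real_distribution_axioms_def)
    show "AE s in distr N borel c. \<bar>s\<bar> \<le> B"
      using c(2) by (subst AE_distr_iff) (auto intro: cm)
    fix \<phi> :: "real \<Rightarrow> complex" assume \<phi>: "continuous_on UNIV \<phi>"
    have [measurable]: "\<phi> \<in> borel_measurable borel"
      using \<phi> by (rule borel_measurable_continuous_onI)
    have si: "set_integrable lborel {0..1} (\<lambda>t. of_real (D t) * \<phi> (c t))"
      by (intro borel_integrable_atLeastAtMost' continuous_intros continuous_on_subset[OF D(1)]
          continuous_on_compose2[OF \<phi> continuous_on_subset[OF c(1)]]) auto
    have "(\<integral>s. \<phi> s \<partial>distr N borel c) = (\<integral>t. \<phi> (c t) \<partial>N)"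
      by (rule integral_distr) auto
    also have "\<dots> = (\<integral>t. (indicator {0..1} t * D t) *\<^sub>R \<phi> (c t) \<partial>lborel)"
      unfolding N_def using D(2) by (intro integral_density) auto
    also have "\<dots> = set_lebesgue_integral lborel {0..1} (\<lambda>t. of_real (D t) * \<phi> (c t))"
      unfolding set_lebesgue_integral_def by (simp add: scaleR_conv_of_real mult_ac)
    also have "\<dots> = integral {0..1} (\<lambda>t. of_real (D t) * \<phi> (c t))"
      by (rule set_borel_integral_eq_integral(2)[OF si])
    finally show "(\<integral>s. \<phi> s \<partial>distr N borel c) = \<dots>" .
  qed
qed

text \<open>The Joukowski map \<open>2 k / (1 + k^2)\<close> sends the unit disc to the slit plane and turns
  \<open>1 / (1 - t s)\<close> into a multiple of the kernel \<open>1 / (1 - 2 k t + k^2)\<close>. On the circle of radius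
  \<open>\<rho> < 1\<close> the boundary values exist, and the imaginary part has the sign of \<open>sin\<close>, so their product is
  a density in \<open>t = cos \<theta>\<close>. The slit-plane distribution is the weak limit for \<open>\<rho> \<rightarrow> 1\<close>.\<close>

lemma dilated_slit_plane_distribution:
  assumes q: "q holomorphic_on slit 1" "q 0 = 1"
    and sym: "\<And>s. s \<in> slit 1 \<Longrightarrow> q (cnj s) = cnj (q s)"
    and pos: "\<And>s. Im s > 0 \<Longrightarrow> Im (s * q s) \<ge> 0"
    and \<rho>: "0 < \<rho>" "\<rho> < 1"
  obtains \<nu> where "real_distribution \<nu>" "AE t in \<nu>. \<bar>t\<bar> \<le> 1"
    "\<And>k \<phi>. norm k < 1 \<Longrightarrow> continuous_on UNIV \<phi> \<Longrightarrow>
       (\<And>t. \<bar>t\<bar> \<le> 1 \<Longrightarrow> \<phi> t = 1 / (1 - 2 * k * of_real t + k\<^sup>2)) \<Longrightarrow>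
      (\<integral>t. \<phi> t \<partial>\<nu>) = q (2 * (of_real \<rho> * k) / (1 + (of_real \<rho> * k)\<^sup>2)) / (1 + (of_real \<rho> * k)\<^sup>2)"
proof -
  define J :: "complex \<Rightarrow> complex" where "J = (\<lambda>z. 2 * z / (1 + z\<^sup>2))"
  \<comment> \<open>The factor in front of \<open>q\<close> makes \<open>\<rho> * z * f z\<close>
    equal to \<open>s * q s\<close> at \<open>s = J (\<rho> * z)\<close>, which is the quantity that
    \<open>pos\<close> controls.\<close>
  define f where "f = (\<lambda>z. 2 / (1 + (of_real \<rho> * z)\<^sup>2) * q (J (of_real \<rho> * z)))"
  have small: "norm (of_real \<rho> * z) < 1" if "norm z \<le> 1" for z :: complex
  proof -
    have "norm (of_real \<rho> * z) \<le> \<rho>" using that \<rho> by (simp add: norm_mult mult_left_le)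
    then show ?thesis using \<rho> by linarith
  qed
  have nz: "1 + (of_real \<rho> * z)\<^sup>2 \<noteq> 0" and J: "J (of_real \<rho> * z) \<in> slit 1" if "norm z \<le> 1" for z :: complex
    using Joukowski_in_slit[OF small[OF that]] by (auto simp: J_def)
  have hf: "f holomorphic_on cball 0 1"
  proof -
    have "(\<lambda>z. J (of_real \<rho> * z)) holomorphic_on cball 0 1"
      unfolding J_def using nz by (intro holomorphic_intros) auto
    then have "(q \<circ> (\<lambda>z. J (of_real \<rho> * z))) holomorphic_on cball 0 1"
      using J by (intro holomorphic_on_compose_gen[OF _ q(1)]) auto
    then show ?thesis
      unfolding f_def using nz by (intro holomorphic_intros) (auto simp: o_def)
  qed
  have fsym: "f (cnj z) = cnj (f z)" if "norm z \<le> 1" for z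
  proof -
    have "J (of_real \<rho> * cnj z) = cnj (J (of_real \<rho> * z))" by (simp add: J_def)
    then show ?thesis using sym[OF J[OF that]] by (simp add: f_def)
  qed
  define E where "E = (\<lambda>t::real. cis (2 * pi * t))"
  define D where "D = (\<lambda>t. sin (2 * pi * t) * Im (E t * f (E t)))"
  have nE: "norm (E t) = 1" for t by (simp add: E_def)
  have ker: "((\<lambda>t. of_real (D t) / (1 - 2 * k * of_real (cos (2 * pi * t)) + k\<^sup>2)) has_integral f k / 2) {0..1}"
    if "norm k < 1" for k
    using sin_kernel_integral[OF hf that fsym] by (simp add: D_def E_def)
  have Dpos: "D t \<ge> 0" for t
  proof -
    let ?z = "of_real \<rho> * E t" and ?s = "J (of_real \<rho> * E t)"
    have up: "Im (?z * f (E t)) = Im (?s * q ?s)"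
      by (simp add: f_def J_def mult_ac)
    have Ims: "Im ?s = 2 * Im ?z * (1 - (norm ?z)\<^sup>2) / (norm (1 + ?z\<^sup>2))\<^sup>2"
      unfolding J_def by (rule Im_Joukowski)
    have "(norm ?z)\<^sup>2 < 1" using small[of "E t"] nE by (simp add: abs_square_less_1)
    then have fac: "(1 - (norm ?z)\<^sup>2) / (norm (1 + ?z\<^sup>2))\<^sup>2 > 0"
      using nz[of "E t"] nE by simp
    have Ims': "Im ?s = 2 * \<rho> * sin (2 * pi * t) * ((1 - (norm ?z)\<^sup>2) / (norm (1 + ?z\<^sup>2))\<^sup>2)"
      unfolding Ims by (simp add: E_def)
    have Jz: "?s \<in> slit 1" using J nE by simp
    \<comment> \<open>By \<open>Ims'\<close> the sine and \<open>Im s\<close> have the same sign;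
      below the real axis \<open>sym\<close> turns \<open>pos\<close> into the opposite
      inequality.\<close>
    have "0 \<le> sin (2 * pi * t) * Im (?s * q ?s)"
    proof (cases "sin (2 * pi * t)" "0::real" rule: linorder_cases)
      case greater
      then have "Im ?s > 0" unfolding Ims' using fac \<rho> by (intro mult_pos_pos) auto
      then show ?thesis using pos greater by simp
    next
      case less
      then have "Im ?s < 0" unfolding Ims' using fac \<rho> by (intro mult_neg_pos mult_pos_neg) auto
      then have "Im (cnj ?s * q (cnj ?s)) \<ge> 0" using pos[of "cnj ?s"] by simp
      then have "Im (cnj (?s * q ?s)) \<ge> 0" by (simp only: complex_cnj_mult sym[OF Jz])
      then have "Im (?s * q ?s) \<le> 0" by simp
      then show ?thesis using less by (simp add: mult_nonpos_nonpos)
    qed simp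
    also have "\<dots> = \<rho> * D t" unfolding D_def up[symmetric] by (simp add: algebra_simps)
    finally show ?thesis using \<rho> by (simp add: zero_le_mult_iff)
  qed
  have Dcont: "continuous_on UNIV D"
  proof -
    have "continuous_on UNIV E" unfolding E_def by (intro continuous_intros)
    moreover from this have "continuous_on UNIV (\<lambda>t. f (E t))"
      by (rule continuous_on_compose2[OF holomorphic_on_imp_continuous_on[OF hf]]) (use nE in auto)
    ultimately show ?thesis unfolding D_def by (intro continuous_intros)
  qed
  \<comment> \<open>At \<open>k = 0\<close> the kernel is 1, so the normalisation
    \<open>q 0 = 1\<close> becomes total mass 1.\<close>
  have "f 0 = 2" using q(2) by (simp add: f_def J_def)
  then have "((\<lambda>t. of_real (D t)) has_integral (1::complex)) {0..1}" using ker[of 0] by simp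
  then have "((\<lambda>t. Re (of_real (D t))) has_integral Re 1) {0..1}"
    by (rule has_integral_Re)
  then have Dint: "(D has_integral 1) {0..1}" by simp
  obtain \<nu> where \<nu>: "real_distribution \<nu>" "AE s in \<nu>. \<bar>s\<bar> \<le> 1"
    "\<And>\<phi> :: real \<Rightarrow> complex. continuous_on UNIV \<phi> \<Longrightarrow>
      (\<integral>s. \<phi> s \<partial>\<nu>) = integral {0..1} (\<lambda>t. of_real (D t) * \<phi> (cos (2 * pi * t)))"
    by (rule distribution_with_parametrized_density[OF Dcont Dpos Dint, of "\<lambda>t. cos (2 * pi * t)" 1])
       (auto intro!: continuous_intros)
  show thesis
  proof (rule that[OF \<nu>(1,2)])
    fix k :: complex and \<phi> :: "real \<Rightarrow> complex" assume k: "norm k < 1" and \<phi>: "continuous_on UNIV \<phi>"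
      "\<And>t. \<bar>t\<bar> \<le> 1 \<Longrightarrow> \<phi> t = 1 / (1 - 2 * k * of_real t + k\<^sup>2)"
    have "(\<integral>t. \<phi> t \<partial>\<nu>) = integral {0..1} (\<lambda>t. of_real (D t) / (1 - 2 * k * of_real (cos (2 * pi * t)) + k\<^sup>2))"
      unfolding \<nu>(3)[OF \<phi>(1)] by (simp add: \<phi>(2))
    also have "\<dots> = f k / 2" by (rule integral_unique[OF ker[OF k]])
    finally show "(\<integral>t. \<phi> t \<partial>\<nu>) = q (2 * (of_real \<rho> * k) / (1 + (of_real \<rho> * k)\<^sup>2)) / (1 + (of_real \<rho> * k)\<^sup>2)"
      by (simp only: f_def J_def times_divide_eq_left divide_divide_eq_left
          mult_divide_mult_cancel_left[OF zero_neq_numeral[symmetric]] mult.commute[of _ 2])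
  qed
qed

text \<open>The common bound makes the sequence tight, so Helly selection applies. The support of
  \<open>M\<close> is left open here; a clamp deals with it in
  \<open>slit_plane_moment_transform\<close>.\<close>

lemma weak_limit_bounded_support:
  fixes \<nu> :: "nat \<Rightarrow> real measure"
  assumes \<nu>: "\<And>n. real_distribution (\<nu> n)" "\<And>n. AE t in \<nu> n. \<bar>t\<bar> \<le> B"
  obtains r M where "strict_mono (r :: nat \<Rightarrow> nat)" "real_distribution M" "weak_conv_m (\<nu> \<circ> r) M"
proof -
  interpret real_distribution "\<nu> n" for n by (rule \<nu>(1))
  have "tight \<nu>"
    unfolding tight_def
  proof safe
    fix \<epsilon> :: real assume "\<epsilon> > 0"
    have "measure (\<nu> n) {- (\<bar>B\<bar> + 1)<..\<bar>B\<bar> + 1} = 1" for n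
      using \<nu>(2)[of n] by (subst prob_eq_1) (auto elim!: eventually_mono)
    then show "\<exists>a b. a < b \<and> (\<forall>n. 1 - \<epsilon> < measure (\<nu> n) {a<..b})"
      using \<open>\<epsilon> > 0\<close> by (intro exI[of _ "- (\<bar>B\<bar> + 1)"] exI[of _ "\<bar>B\<bar> + 1"]) auto
  qed (rule \<nu>(1))
  from tight_imp_convergent_subsubsequence[OF this strict_mono_id] that show thesis by auto
qed

text \<open>The hypotheses express what holds for every distribution on \<open>[-1, 1]\<close>,
  because \<open>Im (s / (1 - t s)) = Im s / |1 - t s|^2\<close>. The conclusion is stated on the
  unit disc, where \<open>Joukowski_preimage\<close> supplies the parameter
  \<open>k\<close>.\<close>

theorem slit_plane_moment_transform:
  assumes q: "q holomorphic_on slit 1" "q 0 = 1"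
    and sym: "\<And>s. s \<in> slit 1 \<Longrightarrow> q (cnj s) = cnj (q s)"
    and pos: "\<And>s. Im s > 0 \<Longrightarrow> Im (s * q s) \<ge> 0"
  obtains \<mu> where "real_distribution \<mu>" "AE t in \<mu>. \<bar>t\<bar> \<le> 1"
    "\<And>s. norm s < 1 \<Longrightarrow> moment_transform \<mu> s = q s"
proof -
  \<comment> \<open>The offset 2 keeps the radius positive already at \<open>n = 0\<close>.\<close>
  define \<rho> where "\<rho> n = 1 - 1 / real (n + 2)" for n
  have \<rho>: "0 < \<rho> n" "\<rho> n < 1" for n by (simp_all add: \<rho>_def)
  have \<rho>1: "\<rho> \<longlonglongrightarrow> 1"
    using tendsto_diff[OF tendsto_const[of "1::real"] LIMSEQ_ignore_initial_segment[OF lim_1_over_n, of 2]]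
    by (simp add: \<rho>_def[abs_def] add.commute)
  have "\<exists>\<nu>. real_distribution \<nu> \<and> (AE t in \<nu>. \<bar>t\<bar> \<le> 1) \<and>
    (\<forall>k \<phi>. norm k < 1 \<longrightarrow> continuous_on UNIV \<phi> \<longrightarrow>
       (\<forall>t. \<bar>t\<bar> \<le> 1 \<longrightarrow> \<phi> t = 1 / (1 - 2 * k * of_real t + k\<^sup>2)) \<longrightarrow>
      (\<integral>t. \<phi> t \<partial>\<nu>) = q (2 * (of_real (\<rho> n) * k) / (1 + (of_real (\<rho> n) * k)\<^sup>2)) / (1 + (of_real (\<rho> n) * k)\<^sup>2))" for n
    by (rule dilated_slit_plane_distribution[OF q sym pos \<rho>, of n]) auto
  then obtain \<nu> where \<nu>: "\<And>n. real_distribution (\<nu> n)" "\<And>n. AE t in \<nu> n. \<bar>t\<bar> \<le> 1"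
    "\<And>n k \<phi>. norm k < 1 \<Longrightarrow> continuous_on UNIV \<phi> \<Longrightarrow>
       (\<And>t. \<bar>t\<bar> \<le> 1 \<Longrightarrow> \<phi> t = 1 / (1 - 2 * k * of_real t + k\<^sup>2)) \<Longrightarrow>
      (\<integral>t. \<phi> t \<partial>\<nu> n) = q (2 * (of_real (\<rho> n) * k) / (1 + (of_real (\<rho> n) * k)\<^sup>2)) / (1 + (of_real (\<rho> n) * k)\<^sup>2)"
    by metis
  obtain r M where r: "strict_mono r" and M: "real_distribution M" and w: "weak_conv_m (\<nu> \<circ> r) M"
    by (rule weak_limit_bounded_support[OF \<nu>(1,2)])
  interpret M: real_distribution M by (rule M)
  \<comment> \<open>Weak convergence needs test functions that are bounded and continuous on the
    whole line, but \<open>1 / (1 - t s)\<close> may have a real pole outside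
    \<open>[-1, 1]\<close>. Clamping removes it, leaves the integrals against \<open>\<nu> n\<close>
    unchanged, and forces the image of the limit \<open>M\<close> into
    \<open>[-1, 1]\<close>.\<close>
  define cl where "cl t = max (-1) (min 1 t)" for t :: real
  have cl: "\<bar>cl t\<bar> \<le> 1" "\<bar>t\<bar> \<le> 1 \<Longrightarrow> cl t = t" for t by (auto simp: cl_def)
  have clc: "continuous_on UNIV cl" unfolding cl_def by (intro continuous_intros)
  have clm: "cl \<in> measurable M borel" using clc by (simp add: borel_measurable_continuous_onI)
  show thesis
  proof (rule that[of "distr M borel cl"])
    show "real_distribution (distr M borel cl)"
      by (intro real_distribution.intro M.prob_space_distr clm) (auto simp: real_distribution_axioms_def)
    show "AE t in distr M borel cl. \<bar>t\<bar> \<le> 1"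
      using cl(1) by (subst AE_distr_iff) (auto intro: clm)
    fix s :: complex assume s: "norm s < 1"
    obtain k where k: "norm k < 1" "1 + k\<^sup>2 \<noteq> 0" "2 * k / (1 + k\<^sup>2) = s"
      by (rule Joukowski_preimage[OF s])
    have ss: "s \<in> slit 1" using Joukowski_in_slit(1)[OF k(1)] k(3) by simp
    have ker: "1 - 2 * k * of_real t + k\<^sup>2 = (1 + k\<^sup>2) * (1 - of_real t * s)" for t
      using k(2) unfolding k(3)[symmetric] by (simp add: field_simps)
    define \<phi> where "\<phi> t = 1 / (1 - of_real (cl t) * s)" for t
    have nz: "1 - of_real (cl t) * s \<noteq> 0" for t by (rule one_minus_slit_nonzero[OF ss cl(1)])
    have \<phi>c: "continuous_on UNIV \<phi>"
      unfolding \<phi>_def using nz by (intro continuous_intros clc) auto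
    have "range \<phi> = \<phi> ` {-1..1}"
    proof -
      have "\<phi> t = \<phi> (cl t)" "cl t \<in> {-1..1}" for t using cl(1)[of t] by (auto simp: \<phi>_def cl(2) abs_le_iff)
      then show ?thesis by (metis (no_types, lifting) image_cong image_subset_iff subset_UNIV subset_antisym image_mono rangeI imageI)
    qed
    moreover have "compact (\<phi> ` {-1..1})"
      by (intro compact_continuous_image continuous_on_subset[OF \<phi>c]) auto
    ultimately have "bounded (range \<phi>)" by (simp add: compact_imp_bounded)
    then obtain B where B: "\<And>t. norm (\<phi> t) \<le> B" by (auto simp: bounded_iff)
    have val: "(\<integral>t. \<phi> t \<partial>\<nu> n) = (1 + k\<^sup>2) *
        (q (2 * (of_real (\<rho> n) * k) / (1 + (of_real (\<rho> n) * k)\<^sup>2)) / (1 + (of_real (\<rho> n) * k)\<^sup>2))" for n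
    proof -
      have "(\<integral>t. \<phi> t / (1 + k\<^sup>2) \<partial>\<nu> n)
        = q (2 * (of_real (\<rho> n) * k) / (1 + (of_real (\<rho> n) * k)\<^sup>2)) / (1 + (of_real (\<rho> n) * k)\<^sup>2)"
      proof (rule \<nu>(3)[OF k(1)])
        show "continuous_on UNIV (\<lambda>t. \<phi> t / (1 + k\<^sup>2))"
          using k(2) by (intro continuous_intros \<phi>c) auto
        show "\<phi> t / (1 + k\<^sup>2) = 1 / (1 - 2 * k * of_real t + k\<^sup>2)" if "\<bar>t\<bar> \<le> 1" for t
          unfolding ker by (simp add: \<phi>_def cl(2)[OF that] mult.commute)
      qed
      then show ?thesis using k(2) by (simp add: field_simps)
    qed
    have "(\<lambda>n. \<integral>t. \<phi> t \<partial>(\<nu> \<circ> r) n) \<longlonglongrightarrow> (\<integral>t. \<phi> t \<partial>M)"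
      by (rule weak_conv_imp_integral_bdd_continuous_conv[OF _ M w _ B])
         (use \<nu>(1) \<phi>c in \<open>auto simp: continuous_on_eq_continuous_at\<close>)
    moreover have "(\<lambda>n. \<integral>t. \<phi> t \<partial>(\<nu> \<circ> r) n) \<longlonglongrightarrow> q s"
    proof -
      have "(\<lambda>n. of_real (\<rho> n) * k) \<longlonglongrightarrow> of_real 1 * k"
        by (intro tendsto_intros \<rho>1)
      then have lk: "(\<lambda>n. of_real (\<rho> n) * k) \<longlonglongrightarrow> k" by simp
      have "isCont q s"
        using holomorphic_on_imp_continuous_on[OF q(1)] ss open_slit[of 1]
        by (simp add: continuous_on_eq_continuous_at)
      moreover have "(\<lambda>n. 2 * (of_real (\<rho> n) * k) / (1 + (of_real (\<rho> n) * k)\<^sup>2)) \<longlonglongrightarrow> s"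
        unfolding k(3)[symmetric] by (intro tendsto_intros lk k(2))
      ultimately have "(\<lambda>n. q (2 * (of_real (\<rho> n) * k) / (1 + (of_real (\<rho> n) * k)\<^sup>2))) \<longlonglongrightarrow> q s"
        by (rule isCont_tendsto_compose)
      then have "(\<lambda>n. \<integral>t. \<phi> t \<partial>\<nu> n) \<longlonglongrightarrow> (1 + k\<^sup>2) * (q s / (1 + k\<^sup>2))"
        unfolding val by (intro tendsto_intros lk k(2))
      then have "(\<lambda>n. \<integral>t. \<phi> t \<partial>\<nu> n) \<longlonglongrightarrow> q s" using k(2) by simp
      from LIMSEQ_subseq_LIMSEQ[OF this r] show ?thesis by (simp add: o_def)
    qed
    ultimately have "(\<integral>t. \<phi> t \<partial>M) = q s" by (rule LIMSEQ_unique)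
    moreover have "moment_transform (distr M borel cl) s = (\<integral>t. \<phi> t \<partial>M)"
      unfolding moment_transform_def \<phi>_def by (rule integral_distr[OF clm]) simp
    ultimately show "moment_transform (distr M borel cl) s = q s" by simp
  qed
qed

section \<open>Inverse branches of quadratic and cubic polynomials on slit planes\<close>

lemma quadratic_inverse_branch:
  fixes b :: real
  assumes b: "b \<noteq> 0"
  obtains d r where "d > 0" "r holomorphic_on slit d" "r 0 = 0"
    "\<And>s. s \<in> slit d \<Longrightarrow> r s * (1 - of_real b * r s) = s"
proof -
  define r where "r s = (1 - csqrt (1 - 4 * of_real b * s)) / (2 * of_real b)" for s
  \<comment> \<open>The critical value of \<open>z (1 - b z)\<close> is \<open>1 / (4 b)\<close>,
    the branch point of the square root; \<open>d\<close> is its modulus.\<close>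
  define d where "d = 1 / (4 * \<bar>b\<bar>)"
  have nn: "1 - 4 * of_real b * s \<notin> \<real>\<^sub>\<le>\<^sub>0" if s: "s \<in> slit d" for s
  proof
    assume "1 - 4 * of_real b * s \<in> \<real>\<^sub>\<le>\<^sub>0"
    then have "Im (4 * of_real b * s) = 0" "Re (4 * of_real b * s) \<ge> 1"
      by (auto simp: complex_nonpos_Reals_iff)
    then have i: "Im s = 0" and r: "4 * b * Re s \<ge> 1" using b by auto
    from s i have "\<bar>Re s\<bar> < d" by (simp add: slit_def)
    then have "4 * \<bar>b\<bar> * \<bar>Re s\<bar> < 1" using b by (simp add: d_def field_simps)
    moreover have "4 * b * Re s \<le> 4 * \<bar>b\<bar> * \<bar>Re s\<bar>" by (metis abs_ge_self abs_mult abs_numeral)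
    ultimately show False using r by linarith
  qed
  show thesis
  proof (rule that[of d r])
    show "d > 0" using b by (simp add: d_def)
    show "r 0 = 0" by (simp add: r_def)
    show "r holomorphic_on slit d"
      unfolding r_def using nn b by (intro holomorphic_intros) auto
    fix s
    have "r s * (1 - of_real b * r s) = (1 - (csqrt (1 - 4 * of_real b * s))\<^sup>2) / (4 * of_real b)"
      using b by (simp add: r_def field_simps power2_eq_square)
    also have "\<dots> = s" using b by (simp add: field_simps)
    finally show "r s * (1 - of_real b * r s) = s" .
  qed
qed

text \<open>An affine change of variables on both sides turns the cubic into the Chebyshev polynomial
  \<open>4 y ^ 3 - 3 y\<close>, so trisecting an angle inverts it. Among the three branches one picks the one
  that vanishes at \<open>0\<close>.\<close>

lemma Chebyshev_inverse_branch:
  fixes \<alpha> \<beta> \<gamma> \<delta> :: real and P :: "complex \<Rightarrow> complex"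
  assumes P: "\<And>y. P (of_real \<alpha> + of_real \<beta> * y) = of_real \<gamma> + of_real \<delta> * (4 * y ^ 3 - 3 * y)"
    and P0: "P 0 = 0" and \<beta>: "\<beta> \<noteq> 0" and \<gamma>: "\<bar>\<gamma>\<bar> < \<delta>"
  obtains d r where "d > 0" "r holomorphic_on slit d" "r 0 = 0"
    "\<And>s. s \<in> slit d \<Longrightarrow> P (r s) = s"
proof -
  \<comment> \<open>The critical values of \<open>P\<close> are \<open>\<gamma> + \<delta>\<close>
    and \<open>\<gamma> - \<delta>\<close>. Zero lies strictly between them, and \<open>d\<close> is
    its distance to the nearer one.\<close>
  define d where "d = \<delta> - \<bar>\<gamma>\<bar>"
  define c :: "complex \<Rightarrow> complex" where "c s = (s - of_real \<gamma>) / of_real \<delta>" for s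
  have c: "Im (c s) = 0 \<Longrightarrow> \<bar>Re (c s)\<bar> < 1" if "s \<in> slit d" for s
  proof -
    assume "Im (c s) = 0"
    then have "Im s = 0" using \<gamma> by (auto simp: c_def)
    then have "\<bar>Re s\<bar> < d" using that by (simp add: slit_def)
    then have "\<bar>Re s - \<gamma>\<bar> < \<delta>" by (simp add: d_def)
    then show "\<bar>Re (c s)\<bar> < 1" using \<gamma> by (simp add: c_def abs_divide)
  qed
  \<comment> \<open>The root 0 of \<open>P\<close> has coordinate
    \<open>y = - \<alpha> / \<beta>\<close>, and \<phi> is its angle. Then
    \<open>cos (3 * \<phi>) = c 0\<close>, so \<open>3 * \<phi>\<close> is
    \<open>Arccos (c 0)\<close> up to sign and a multiple of \<open>2 * pi\<close>. That multiple,
    negated if the sign is negative, selects the branch.\<close>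
  define \<phi> where "\<phi> = Arccos (of_real (- \<alpha> / \<beta>))"
  have cos\<phi>: "of_real \<alpha> + of_real \<beta> * cos \<phi> = 0" using \<beta> by (simp add: \<phi>_def)
  then have "of_real \<gamma> + of_real \<delta> * cos (3 * \<phi>) = 0"
    using P[of "cos \<phi>"] P0 by (simp add: cos_treble_cos)
  then have "cos (3 * \<phi>) = cos (Arccos (c 0))"
    using \<gamma> by (simp add: c_def field_simps eq_neg_iff_add_eq_0)
  then obtain n where n: "3 * \<phi> = Arccos (c 0) + of_real (2 * n * pi) \<or> 3 * \<phi> = - Arccos (c 0) + of_real (2 * n * pi)"
    "n \<in> \<int>" unfolding complex_cos_eq by blast
  obtain m where m: "m \<in> \<int>" "cos ((Arccos (c 0) + of_real (2 * m * pi)) / 3) = cos \<phi>"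
  proof (rule disjE[OF n(1)])
    assume "3 * \<phi> = Arccos (c 0) + of_real (2 * n * pi)"
    then have "(Arccos (c 0) + of_real (2 * n * pi)) / 3 = \<phi>" by (simp add: field_simps)
    then show thesis using that n(2) by metis
  next
    assume "3 * \<phi> = - Arccos (c 0) + of_real (2 * n * pi)"
    then have "(Arccos (c 0) + of_real (2 * (- n) * pi)) / 3 = - \<phi>" by (simp add: field_simps)
    then show thesis using that[of "- n"] n(2) by (metis cos_minus Ints_minus)
  qed
  define r where "r s = of_real \<alpha> + of_real \<beta> * cos ((Arccos (c s) + of_real (2 * m * pi)) / 3)" for s
  show thesis
  proof (rule that[of d r])
    show "d > 0" using \<gamma> by (simp add: d_def)
    show "r 0 = 0" unfolding r_def m(2) by (rule cos\<phi>)
    have "(Arccos \<circ> c) holomorphic_on slit d"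
    proof (rule holomorphic_on_compose)
      show "c holomorphic_on slit d" unfolding c_def using \<gamma> by (intro holomorphic_intros) auto
      show "Arccos holomorphic_on c ` slit d" using c by (intro holomorphic_on_Arccos) auto
    qed
    then show "r holomorphic_on slit d"
      unfolding r_def by (intro holomorphic_intros) (auto simp: o_def)
    fix s
    have "P (r s) = of_real \<gamma> + of_real \<delta> * cos (Arccos (c s) + of_real (2 * m * pi))"
      unfolding r_def P cos_treble_cos[symmetric] by (simp only: times_divide_eq_right
          nonzero_mult_div_cancel_left[OF zero_neq_numeral[symmetric]])
    also have "cos (Arccos (c s) + of_real (2 * m * pi)) = cos (Arccos (c s))"
      using m(1) by (subst complex_cos_eq) blast
    also have "of_real \<gamma> + of_real \<delta> * cos (Arccos (c s)) = s"
      using \<gamma> by (auto simp: c_def)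
    finally show "P (r s) = s" .
  qed
qed

text \<open>The squares of the two sides differ by \<open>27 (a b (a - b))^2\<close>, the discriminant up to a
  factor. The bound says that the critical values of \<open>z (1 - a z) (1 - b z)\<close> have opposite signs.\<close>

lemma discriminant_bound:
  fixes a b :: real
  assumes "a \<noteq> b" "a \<noteq> 0" "b \<noteq> 0"
  shows "\<bar>(a + b) * (2 * b - a) * (2 * a - b)\<bar> < 2 * sqrt (a\<^sup>2 - a * b + b\<^sup>2) ^ 3"
proof (rule power2_less_imp_less)
  have nn: "a\<^sup>2 - a * b + b\<^sup>2 \<ge> 0"
  proof -
    have "a\<^sup>2 - a * b + b\<^sup>2 = ((a - b)\<^sup>2 + a\<^sup>2 + b\<^sup>2) / 2" by (simp add: power2_diff)
    then show ?thesis by (simp only:) simp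
  qed
  have "(2 * sqrt (a\<^sup>2 - a * b + b\<^sup>2) ^ 3)\<^sup>2 = 4 * ((sqrt (a\<^sup>2 - a * b + b\<^sup>2))\<^sup>2) ^ 3"
    by (simp add: power_mult_distrib flip: power_mult)
  also have "\<dots> = 4 * (a\<^sup>2 - a * b + b\<^sup>2) ^ 3" using nn by simp
  also have "\<dots> = \<bar>(a + b) * (2 * b - a) * (2 * a - b)\<bar>\<^sup>2 + 27 * (a * b * (a - b))\<^sup>2"
    unfolding power2_abs by algebra
  finally show "\<bar>(a + b) * (2 * b - a) * (2 * a - b)\<bar>\<^sup>2 < (2 * sqrt (a\<^sup>2 - a * b + b\<^sup>2) ^ 3)\<^sup>2"
    using assms by simp
  show "0 \<le> 2 * sqrt (a\<^sup>2 - a * b + b\<^sup>2) ^ 3" using nn by simp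
qed

lemma cubic_inverse_branch:
  fixes a b :: real
  assumes ab: "a \<noteq> b"
  obtains d r where "d > 0" "r holomorphic_on slit d" "r 0 = 0"
    "\<And>s. s \<in> slit d \<Longrightarrow> r s * (1 - of_real a * r s) * (1 - of_real b * r s) = s"
proof (cases "a = 0 \<or> b = 0")
  case True
  \<comment> \<open>The degree drops to 2, and \<open>a + b\<close> is whichever of the two
    coefficients is nonzero.\<close>
  then have "a + b \<noteq> 0" using ab by auto
  then obtain d r where "d > 0" "r holomorphic_on slit d" "r 0 = 0"
    "\<And>s. s \<in> slit d \<Longrightarrow> r s * (1 - of_real (a + b) * r s) = s"
    by (rule quadratic_inverse_branch) blast
  moreover have "z * (1 - of_real (a + b) * z) = z * (1 - of_real a * z) * (1 - of_real b * z)"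
    for z :: complex using True by auto
  ultimately show thesis using that[of d r] by metis
next
  case False
  then have a: "a \<noteq> 0" and b: "b \<noteq> 0" by auto
  define Q where "Q = sqrt (a\<^sup>2 - a * b + b\<^sup>2)"
  have lt: "\<bar>(a + b) * (2 * b - a) * (2 * a - b)\<bar> < 2 * Q ^ 3"
    unfolding Q_def by (rule discriminant_bound[OF ab a b])
  then have "Q ^ 3 > 0" by linarith
  then have Q0: "Q > 0" by (simp add: zero_less_power_eq)
  then have Q2: "Q\<^sup>2 = a\<^sup>2 - a * b + b\<^sup>2" by (simp add: Q_def)
  define e where "e = 27 * a\<^sup>2 * b\<^sup>2"
  have e: "e > 0" using a b by (simp add: e_def)
  \<comment> \<open>Here \<alpha> is the inflection point of the cubic and \<gamma> its value there.
    The critical points \<open>(a + b + Q) / (3 a b)\<close> and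
    \<open>(a + b - Q) / (3 a b)\<close> correspond to \<open>y = 1/2\<close> and
    \<open>y = -1/2\<close>, those of \<open>4 y^3 - 3 y\<close>; this fixes \<beta>, and comparing
    leading coefficients fixes \<delta>.\<close>
  define \<gamma> where "\<gamma> = (a + b) * (2 * b - a) * (2 * a - b) / e"
  define \<delta> where "\<delta> = 2 * Q ^ 3 / e"
  define \<alpha> where "\<alpha> = (a + b) / (3 * a * b)"
  define \<beta> where "\<beta> = 2 * Q / (3 * a * b)"
  show thesis
  proof (rule Chebyshev_inverse_branch[of "\<lambda>z. z * (1 - of_real a * z) * (1 - of_real b * z)" \<alpha> \<beta> \<gamma> \<delta>])
    show "\<beta> \<noteq> 0" using Q0 a b by (simp add: \<beta>_def)
    show "\<bar>\<gamma>\<bar> < \<delta>" using lt e by (simp add: \<gamma>_def \<delta>_def abs_divide divide_strict_right_mono)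
    fix y :: complex
    define A B S :: complex where "A = of_real a" and "B = of_real b" and "S = of_real Q"
    have nz: "A \<noteq> 0" "B \<noteq> 0" using a b by (auto simp: A_def B_def)
    have S2: "S\<^sup>2 = A\<^sup>2 - A * B + B\<^sup>2"
      using arg_cong[OF Q2, of complex_of_real] by (simp add: A_def B_def S_def)
    define z where "z = (A + B + 2 * S * y) / (3 * A * B)"
    have z: "3 * A * B * z = A + B + 2 * S * y" using nz by (simp add: z_def)
    have "27 * A\<^sup>2 * B\<^sup>2 * (z * (1 - A * z) * (1 - B * z))
       = (3 * A * B * z) * (3 * B - 3 * A * B * z) * (3 * A - 3 * A * B * z)"
      by (simp add: algebra_simps power2_eq_square)
    also have "\<dots> = (A + B) * (2 * B - A) * (2 * A - B) + 2 * S ^ 3 * (4 * y ^ 3 - 3 * y)"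
      unfolding z using S2 by algebra
    finally have "z * (1 - A * z) * (1 - B * z) =
        ((A + B) * (2 * B - A) * (2 * A - B) + 2 * S ^ 3 * (4 * y ^ 3 - 3 * y)) / (27 * A\<^sup>2 * B\<^sup>2)"
      using nz by (simp add: field_simps)
    moreover have "of_real \<alpha> + of_real \<beta> * y = z"
      by (simp add: \<alpha>_def \<beta>_def z_def A_def B_def S_def add_divide_distrib)
    ultimately show "(of_real \<alpha> + of_real \<beta> * y) * (1 - of_real a * (of_real \<alpha> + of_real \<beta> * y)) *
        (1 - of_real b * (of_real \<alpha> + of_real \<beta> * y)) = of_real \<gamma> + of_real \<delta> * (4 * y ^ 3 - 3 * y)"
      by (simp add: \<gamma>_def \<delta>_def e_def A_def B_def S_def add_divide_distrib)
  qed (auto intro: that)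
qed

section \<open>Half-plane mapping and reality of the branch\<close>

text \<open>On a branch of the cubic the expression is \<open>r s / s\<close> for nonzero
  \<open>s\<close>, so the limit says that \<open>r\<close> has derivative 1 at 0.\<close>

lemma inverse_branch_quotient_tendsto:
  fixes a b :: complex
  assumes d: "d > 0" and r: "r holomorphic_on slit d" "r 0 = 0"
  shows "((\<lambda>s. inverse ((1 - a * r s) * (1 - b * r s))) \<longlongrightarrow> 1) (at 0)"
proof -
  have "isCont r 0"
    using holomorphic_on_imp_continuous_on[OF r(1)] d open_slit[of d]
    by (auto simp: continuous_on_eq_continuous_at slit_def)
  then have "(r \<longlongrightarrow> 0) (at 0)" using r(2) by (simp add: isCont_def)
  then have "((\<lambda>s. inverse ((1 - a * r s) * (1 - b * r s))) \<longlongrightarrow> inverse ((1 - a * 0) * (1 - b * 0))) (at 0)"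
    by (intro tendsto_intros) auto
  then show ?thesis by simp
qed

text \<open>A real value \<open>r v\<close> would make \<open>v\<close> real, since the cubic has
  real coefficients. So \<open>Im r\<close> has no zero on the connected upper half-plane, and its
  sign is read off near 0 on the imaginary axis, where \<open>r z\<close> is close to
  \<open>z\<close>.\<close>

lemma inverse_branch_Im_pos:
  fixes a b :: real
  assumes d: "d > 0" and r: "r holomorphic_on slit d" "r 0 = 0"
    and P: "\<And>s. s \<in> slit d \<Longrightarrow> r s * (1 - of_real a * r s) * (1 - of_real b * r s) = s"
    and s: "Im s > 0"
  shows "Im (r s) > 0"
proof (rule ccontr)
  assume "\<not> Im (r s) > 0"
  let ?g = "\<lambda>s. inverse ((1 - of_real a * r s) * (1 - of_real b * r s))"
  have up: "z \<in> slit d" if "Im z > 0" for z using that by (simp add: slit_def)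
  have g: "r z = z * ?g z" if "z \<in> slit d" "z \<noteq> 0" for z
  proof -
    define c where "c = (1 - of_real a * r z) * (1 - of_real b * r z)"
    have c: "r z * c = z" using P[OF that(1)] by (simp add: c_def mult.assoc)
    then have "c \<noteq> 0" using that(2) by auto
    with c have "r z = z * inverse c" by (metis divide_inverse nonzero_eq_divide_eq)
    then show ?thesis by (simp only: c_def)
  qed
  have "((\<lambda>z. Re (?g z)) \<longlongrightarrow> Re 1) (at 0)"
    by (intro tendsto_Re inverse_branch_quotient_tendsto[OF d r])
  then have "\<forall>\<^sub>F z in at 0. Re (?g z) > 0"
    by (rule order_tendstoD) simp
  then obtain e where e: "e > 0" "\<And>z. z \<noteq> 0 \<Longrightarrow> norm z < e \<Longrightarrow> Re (?g z) > 0"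
    by (auto simp: eventually_at dist_norm)
  define z where "z = \<i> * of_real (e / 2)"
  have z: "Im z > 0" "z \<noteq> 0" "norm z < e" using e(1) by (auto simp: z_def norm_mult)
  have "Im (r z) = e / 2 * Re (?g z)" by (subst g[OF up[OF z(1)] z(2)]) (simp add: z_def)
  then have "Im (r z) > 0" using mult_pos_pos[OF half_gt_zero[OF e(1)] e(2)[OF z(2,3)]] by (simp only:)
  have "connected ((\<lambda>z. Im (r z)) ` {z. Im z > 0})"
    by (intro connected_continuous_image continuous_intros convex_connected convex_halfspace_Im_gt
        continuous_on_subset[OF holomorphic_on_imp_continuous_on[OF r(1)]]) (auto intro: up)
  then have "0 \<in> (\<lambda>z. Im (r z)) ` {z. Im z > 0}"
    by (rule connected_contains_Icc[THEN subsetD, of _ "Im (r s)" "Im (r z)"])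
       (use s z \<open>Im (r z) > 0\<close> \<open>\<not> Im (r s) > 0\<close> in auto)
  then obtain v where v: "Im v > 0" "Im (r v) = 0" by auto
  then have "r v \<in> \<real>" by (simp add: complex_is_Real_iff)
  then have "r v * (1 - of_real a * r v) * (1 - of_real b * r v) \<in> \<real>" by auto
  then show False using P[OF up[OF v(1)]] v(1) by (simp add: complex_is_Real_iff)
qed

text \<open>The reflected branch solves the same cubic and also vanishes at 0. As 0 is a simple
  root, the two agree near 0, and the identity theorem extends this to the connected slit
  plane.\<close>

lemma inverse_branch_cnj:
  fixes a b :: real
  assumes d: "d > 0" and r: "r holomorphic_on slit d" "r 0 = 0"
    and P: "\<And>s. s \<in> slit d \<Longrightarrow> r s * (1 - of_real a * r s) * (1 - of_real b * r s) = s"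
    and s: "s \<in> slit d"
  shows "r (cnj s) = cnj (r s)"
proof -
  have cs: "cnj z \<in> slit d \<longleftrightarrow> z \<in> slit d" for z by (auto simp: slit_def)
  define r' where "r' = (\<lambda>z. cnj (r (cnj z)))"
  have im: "cnj ` slit d = slit d"
  proof safe
    show "z \<in> cnj ` slit d" if "z \<in> slit d" for z
      using that cs by (intro image_eqI[of _ _ "cnj z"]) auto
  qed (use cs in auto)
  have r': "r' holomorphic_on slit d"
    using holomorphic_on_compose_cnj_cnj[of r "slit d"] r(1) open_slit[of d] by (simp add: im r'_def o_def)
  have P': "r' z * (1 - of_real a * r' z) * (1 - of_real b * r' z) = z" if "z \<in> slit d" for z
    using arg_cong[OF P[of "cnj z"], of cnj] that cs by (simp add: r'_def)
  \<comment> \<open>The divided difference of the cubic at \<open>r z\<close> and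
    \<open>r' z\<close>; it equals 1 at \<open>z = 0\<close>.\<close>
  define g where "g z = 1 - of_real (a + b) * (r z + r' z)
      + of_real (a * b) * ((r z)\<^sup>2 + r z * r' z + (r' z)\<^sup>2)" for z
  have g_factor: "(r z - r' z) * g z = 0" if "z \<in> slit d" for z
  proof -
    have "(r z - r' z) * g z = r z * (1 - of_real a * r z) * (1 - of_real b * r z)
        - r' z * (1 - of_real a * r' z) * (1 - of_real b * r' z)"
      unfolding g_def of_real_add of_real_mult by algebra
    then show ?thesis using P P' that by simp
  qed
  have g: "g holomorphic_on slit d"
    unfolding g_def by (intro holomorphic_intros r r')
  have d0: "0 \<in> slit d" using d by (simp add: slit_def)
  have "isCont g 0"
    using holomorphic_on_imp_continuous_on[OF g] d0 open_slit[of d]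
    by (simp add: continuous_on_eq_continuous_at)
  moreover have "g 0 \<noteq> 0" using r(2) by (simp add: g_def r'_def)
  ultimately obtain e where e: "e > 0" "\<And>z. dist 0 z < e \<Longrightarrow> g z \<noteq> 0"
    using continuous_at_avoid by metis
  have "r s = r' s"
  proof (rule analytic_continuation_open[of "ball 0 e \<inter> slit d" "slit d" r r'])
    show "ball 0 e \<inter> slit d \<noteq> {}" using e(1) d0 IntI[of 0 "ball 0 e" "slit d"] by (metis centre_in_ball empty_iff)
    show "r z = r' z" if "z \<in> ball 0 e \<inter> slit d" for z
      using g_factor[of z] e(2)[of z] that by auto
  qed (use open_slit r r' s connected_slit[OF d] in auto)
  then show ?thesis by (metis complex_cnj_cnj r'_def)
qed

section \<open>The distribution with the given R-transform\<close>

theorem proposition5p1: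
  fixes u x :: real
  shows "\<exists>\<mu> :: real measure. real_distribution \<mu> \<and> compactly_supported \<mu> \<and>
    is_free_R_transform \<mu> (\<lambda>w. (of_real u)^2 * (of_real x)^3 * w^2
      + (1 - of_real x)^3 * of_real u * w / (1 - of_real u * w))"
proof -
  let ?x = "of_real x :: complex"
  \<comment> \<open>The two parameters differ by 1 whatever \<open>x\<close> is, so the roots are
    always distinct.\<close>
  obtain d r where d: "d > 0" and r: "r holomorphic_on slit d" "r 0 = 0"
    and P: "\<And>s. s \<in> slit d \<Longrightarrow> r s * (1 - of_real (- x) * r s) * (1 - of_real (1 - x) * r s) = s"
    by (rule cubic_inverse_branch[of "- x" "1 - x"]) auto
  \<comment> \<open>This is the quotient of \<open>r / (1 + x r)\<close> by \<open>s\<close>,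
    simplified with the cubic so that it makes sense at \<open>s = 0\<close>.\<close>
  define Q where "Q s = 1 / ((1 + ?x * r s)\<^sup>2 * (1 - (1 - ?x) * r s))" for s
  have P': "r s * (1 + ?x * r s) * (1 - (1 - ?x) * r s) = s" if "s \<in> slit d" for s
    using P[OF that] by simp
  have nz: "1 + ?x * r s \<noteq> 0" "1 - (1 - ?x) * r s \<noteq> 0" if "s \<in> slit d" for s
    using P'[OF that] r(2) by fastforce+
  have sQ: "s * Q s = r s / (1 + ?x * r s)" if "s \<in> slit d" for s
    using nz[OF that] by (subst P'[OF that, symmetric]) (simp add: Q_def power2_eq_square)
  have sc: "of_real d * s \<in> slit d" if "s \<in> slit 1" for s
    using slit_scale[OF that d] by simp
  obtain \<nu> where \<nu>: "real_distribution \<nu>" "AE t in \<nu>. \<bar>t\<bar> \<le> 1"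
    "\<And>s. norm s < 1 \<Longrightarrow> moment_transform \<nu> s = Q (of_real d * s)"
  proof (rule slit_plane_moment_transform[of "\<lambda>s. Q (of_real d * s)"])
    have "(\<lambda>s. r (of_real d * s)) holomorphic_on slit 1"
      using holomorphic_on_compose_gen[OF _ r(1), of "\<lambda>s. of_real d * s" "slit 1"] sc
      by (auto simp: o_def intro!: holomorphic_intros)
    then show "(\<lambda>s. Q (of_real d * s)) holomorphic_on slit 1"
      unfolding Q_def using nz sc by (intro holomorphic_intros) auto
    show "Q (of_real d * 0) = 1" by (simp add: Q_def r(2))
    show "Q (of_real d * cnj s) = cnj (Q (of_real d * s))" if "s \<in> slit 1" for s
      using inverse_branch_cnj[OF d r P sc[OF that]] by (simp add: Q_def)
    show "Im (s * Q (of_real d * s)) \<ge> 0" if "Im s > 0" for s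
    proof -
      let ?s = "of_real d * s"
      have "Im ?s > 0" using that d by simp
      then have i: "Im (r ?s) > 0" and S: "?s \<in> slit d"
        using inverse_branch_Im_pos[OF d r P] by (auto simp: slit_def)
      \<comment> \<open>A real Moebius map of determinant 1.\<close>
      have "Im (r ?s / (1 + ?x * r ?s)) = Im (r ?s) / (norm (1 + ?x * r ?s))\<^sup>2"
        unfolding Im_divide cmod_power2 by (simp add: algebra_simps)
      then have "Im (?s * Q ?s) \<ge> 0" unfolding sQ[OF S] using i by simp
      then show ?thesis using d by (simp add: zero_le_mult_iff mult.assoc flip: distrib_left)
    qed
  qed blast
  interpret \<nu>: real_distribution \<nu> by (rule \<nu>(1))
  define \<zeta> where "\<zeta> = 3 * x\<^sup>2 - x ^ 3"
  \<comment> \<open>Undo the rescaling by \<open>d\<close>, shift by \<zeta>, dilate by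
    \<open>u\<close>. For \<open>u = 0\<close> this yields the point mass at 0, with no separate
    case.\<close>
  define h where "h t = u * (\<zeta> + t / d)" for t
  have hm: "h \<in> measurable \<nu> borel" by (simp add: h_def[abs_def])
  define \<mu> where "\<mu> = distr \<nu> borel h"
  \<comment> \<open>For nonzero \<open>u\<close> and \<open>z\<close> this means
    \<open>1 / w z = 1 / (u z) - \<zeta>\<close>, so \<open>w z\<close> is the variable
    \<open>s\<close> of the cubic, not the argument of the R-transform.\<close>
  define w where "w z = of_real u * z / (1 - of_real (u * \<zeta>) * z)" for z :: complex
  define R :: "complex \<Rightarrow> complex" where
    "R = (\<lambda>w. (of_real u)^2 * ?x^3 * w^2 + (1 - ?x)^3 * of_real u * w / (1 - of_real u * w))"
  have M: "moment_transform \<mu> z = Q (w z) / (1 - of_real (u * \<zeta>) * z)"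
    if "1 - of_real (u * \<zeta>) * z \<noteq> 0" "norm (w z) < d" for z
  proof -
    have "moment_transform \<mu> z = (\<integral>t. 1 / (1 - of_real (h t) * z) \<partial>\<nu>)"
      unfolding moment_transform_def \<mu>_def by (rule integral_distr[OF hm]) simp
    also have "1 - of_real (h t) * z = (1 - of_real (u * \<zeta>) * z) * (1 - of_real t * (w z / of_real d))" for t
      using that(1) d by (simp add: h_def w_def field_simps)
    then have "(\<integral>t. 1 / (1 - of_real (h t) * z) \<partial>\<nu>) =
        (\<integral>t. 1 / (1 - of_real t * (w z / of_real d)) / (1 - of_real (u * \<zeta>) * z) \<partial>\<nu>)"
      by (simp add: mult.commute)
    also have "\<dots> = moment_transform \<nu> (w z / of_real d) / (1 - of_real (u * \<zeta>) * z)"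
      unfolding moment_transform_def by (rule integral_divide_zero)
    also have "moment_transform \<nu> (w z / of_real d) = Q (w z)"
      using that(2) d by (subst \<nu>(3)) (auto simp: norm_divide)
    finally show ?thesis .
  qed
  have "R analytic_on {0}"
    unfolding R_def by (intro analytic_intros) auto
  moreover have "\<forall>\<^sub>F z in nhds 0. 1 + R (z * moment_transform \<mu> z) = moment_transform \<mu> z"
  proof -
    have "((\<lambda>z. 1 - of_real (u * \<zeta>) * z) \<longlongrightarrow> 1 - of_real (u * \<zeta>) * 0) (nhds (0::complex))"
      "((\<lambda>z. norm (w z)) \<longlongrightarrow> norm (of_real u * 0 / (1 - of_real (u * \<zeta>) * 0) :: complex)) (nhds 0)"
      unfolding w_def by (intro tendsto_intros filterlim_ident; simp)+
    then have t: "((\<lambda>z. 1 - of_real (u * \<zeta>) * z) \<longlongrightarrow> 1) (nhds (0::complex))"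
      "((\<lambda>z. norm (w z)) \<longlongrightarrow> 0) (nhds 0)"
      by simp_all
    have "\<forall>\<^sub>F z in nhds 0. 1 - of_real (u * \<zeta>) * (z::complex) \<noteq> 0"
      using t(1) by (rule tendsto_imp_eventually_ne) simp
    moreover have "\<forall>\<^sub>F z in nhds 0. norm (w z) < d"
      using t(2) d by (rule order_tendstoD)
    ultimately show ?thesis
    proof eventually_elim
      case (elim z)
      note Mz = M[OF elim]
      define s where "s = w z"
      define p where "p = r s"
      have S: "s \<in> slit d" using elim(2) abs_Re_le_cmod[of s] by (auto simp: slit_def s_def)
      note n = nz[OF S, folded p_def] and Pp = P'[OF S, folded p_def]
      \<comment> \<open>Written without dividing by \<open>u\<close> or \<open>s\<close>, so that it
        also holds at \<open>z = 0\<close> and for \<open>u = 0\<close>.\<close>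
      have uz: "of_real u * z * (1 + of_real \<zeta> * s) = s"
        and s1: "1 / (1 - of_real (u * \<zeta>) * z) = 1 + of_real \<zeta> * s"
        using elim(1) by (simp_all add: s_def w_def field_simps)
      have Mz': "moment_transform \<mu> z = (1 + of_real \<zeta> * s) / ((1 + ?x * p)\<^sup>2 * (1 - (1 - ?x) * p))"
        unfolding Mz s1[symmetric] by (simp add: Q_def s_def p_def)
      have "of_real u * (z * moment_transform \<mu> z) = of_real u * z * (1 + of_real \<zeta> * s) * Q s"
        unfolding Mz' by (simp add: Q_def p_def)
      also have "\<dots> = p / (1 + ?x * p)"
        unfolding uz using sQ[OF S] by (simp add: p_def)
      finally have W: "of_real u * (z * moment_transform \<mu> z) = p / (1 + ?x * p)" .
      \<comment> \<open>\<open>R\<close> depends on its argument only through the product with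
        \<open>u\<close>, so \<open>W\<close> is all that is needed.\<close>
      have "1 + R (z * moment_transform \<mu> z) = 1 + ?x ^ 3 * (p / (1 + ?x * p))\<^sup>2
          + (1 - ?x) ^ 3 * (p / (1 + ?x * p) / (1 - p / (1 + ?x * p)))"
        unfolding R_def W[symmetric] by (simp add: power_mult_distrib mult_ac)
      also have "1 - p / (1 + ?x * p) = (1 - (1 - ?x) * p) / (1 + ?x * p)"
        using n(1) by (simp add: field_simps)
      also have "p / (1 + ?x * p) / ((1 - (1 - ?x) * p) / (1 + ?x * p)) = p / (1 - (1 - ?x) * p)"
        using n by simp
      also have "1 + ?x ^ 3 * (p / (1 + ?x * p))\<^sup>2 + (1 - ?x) ^ 3 * (p / (1 - (1 - ?x) * p))
         = (1 + of_real \<zeta> * s) / ((1 + ?x * p)\<^sup>2 * (1 - (1 - ?x) * p))"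
      proof -
        \<comment> \<open>After \<open>s\<close> is replaced by the cubic in \<open>p\<close> this
          is a polynomial identity. The coefficient of \<open>p\<close> on the left is
          \<open>2 x - (1 - x) + (1 - x)^3 = 3 x^2 - x^3\<close>, which is what forces the value of
          \<zeta>.\<close>
        have "(1 + ?x * p)\<^sup>2 * (1 - (1 - ?x) * p) + ?x ^ 3 * p\<^sup>2 * (1 - (1 - ?x) * p)
            + (1 - ?x) ^ 3 * p * (1 + ?x * p)\<^sup>2 = 1 + of_real \<zeta> * s"
          unfolding Pp[symmetric] \<zeta>_def of_real_diff of_real_mult of_real_power of_real_numeral
          by algebra
        moreover have "1 + A * (p / c)\<^sup>2 + B * (p / e) = (c\<^sup>2 * e + A * p\<^sup>2 * e + B * p * c\<^sup>2) / (c\<^sup>2 * e)"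
          if "c \<noteq> 0" "e \<noteq> 0" for A B c e :: complex
          using that by (simp add: field_simps)
        ultimately show ?thesis using n by simp
      qed
      finally show ?case unfolding Mz' .
    qed
  qed
  ultimately have "is_free_R_transform \<mu> R" by (simp add: is_free_R_transform_def)
  moreover have "real_distribution \<mu>"
    unfolding \<mu>_def
    by (intro real_distribution.intro \<nu>.prob_space_distr hm) (auto simp: real_distribution_axioms_def)
  moreover have "compactly_supported \<mu>"
    unfolding compactly_supported_def
  proof (intro exI conjI)
    show "compact (h ` {-1..1})"
      unfolding h_def using d by (intro compact_continuous_image continuous_intros) auto
    then have "h ` {-1..1} \<in> sets borel" by (intro borel_closed compact_imp_closed)
    moreover have "AE t in \<nu>. h t \<in> h ` {-1..1}"
      using \<nu>(2) by eventually_elim (auto simp: abs_le_iff)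
    ultimately show "AE x in \<mu>. x \<in> h ` {-1..1}"
      unfolding \<mu>_def by (subst AE_distr_iff[OF hm]) auto
  qed
  ultimately show ?thesis unfolding R_def by blast
qed

end
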